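(* Let $\kappa$ be an infinite cardinal. Then $2^{\aleph_0}\leq\kappa^+$ if and only if $\mathbb{R}\setminus\{0\}$ can be covered by $\kappa$-many rationally independent sets.
   Context: $\kappa^+$ denotes the cardinal successor of $\kappa$. A set $X\subseteq\mathbb{R}$ is rationally independent if for any $n\ge 1$, any pairwise distinct $x_0,\dots,x_{n-1}\in X$ and any $q_0,\dots,q_{n-1}\in\mathbb{Q}\setminus\{0\}$ one has $\sum_{i=0}^{n-1}q_ix_i\neq 0$. *)

theory Defs
  imports Complex_Main
begin

unbundle cardinal_syntax

definition rationally_independent :: "real set \<Rightarrow> bool" where
  "rationally_independent X \<longleftrightarrow>
     (\<forall>n\<ge>1. \<forall>(x :: nat \<Rightarrow> real) (q :: nat \<Rightarrow> rat).
        (\<forall>i<n. x i \<in> X) \<and> inj_on x {..<n} \<and> (\<forall>i<n. q i \<noteq> 0) \<longrightarrow>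
        (\<Sum>i<n. of_rat (q i) * x i) \<noteq> 0)"

text \<open>\<open>\<kappa>\<close>-many sets, for a cardinal \<open>\<kappa>\<close>: a family indexed by the elements of
  the field of \<open>\<kappa>\<close>. Repetitions are allowed, as there may be fewer than \<open>\<kappa>\<close>
  sets of reals altogether.\<close>

definition covered_by_rationally_independent :: "'k rel \<Rightarrow> real set \<Rightarrow> bool" where
  "covered_by_rationally_independent \<kappa> A \<longleftrightarrow>
     (\<exists>X :: 'k \<Rightarrow> real set.
        (\<forall>i\<in>Field \<kappa>. rationally_independent (X i)) \<and> A \<subseteq> (\<Union>i\<in>Field \<kappa>. X i))"

end

theory Submission
  imports Defs "HOL-Analysis.Abstract_Topology_2"
begin

text \<open>
  As the reals have cardinality \<open>2\<close> to the \<open>\<aleph>\<^sub>0\<close>, the claim is that a cover by \<open>\<kappa>\<close> rationally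
  independent sets exists if and only if \<open>\<bar>\<real>\<bar> \<le> \<kappa>\<^sup>+\<close>. This generalises the theorem of Erdos and Kakutani
  about the continuum hypothesis.

  If \<open>\<bar>\<real>\<bar> > \<kappa>\<^sup>+\<close>, colour every nonzero real by the index of a covering set that contains it, colour
  \<open>0\<close> arbitrarily, and fix a set \<open>A\<close> of \<open>\<kappa>\<^sup>+\<close> reals. For each real \<open>b\<close>, two of the \<open>\<kappa>\<^sup>+\<close> translates \<open>a + b\<close> with \<open>a \<in> A\<close> share
  one of the \<open>\<kappa>\<close> colours. There are only \<open>\<kappa>\<^sup>+\<close> possibilities for such a pair and its colour, so
  infinitely many \<open>b\<close> share the same \<open>(a, a', k)\<close>
  (\<open>infinite_fibre_if_card_less\<close>). Two suitable ones of these \<open>b\<close> give a rectangle with distinct nonzero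
  corners, all of colour \<open>k\<close>, which satisfy \<open>(a + b) - (a' + b) - (a + b') + (a' + b') = 0\<close>
  (\<open>rationally_independent_no_rectangle\<close>).

  If \<open>\<bar>\<real>\<bar> \<le> \<kappa>\<^sup>+\<close>, well-order the reals so that every proper initial segment has size at most \<open>\<kappa>\<close>. The
  rational spans of the segments up to a given real form a chain of subspaces of size at most \<open>\<kappa>\<close>, and every
  real \<open>x\<close> lies in a least one, \<open>W x\<close>, which serves as its level
  (\<open>ex_small_subspace_filtration\<close>). Colour \<open>x\<close> by its image under an injection of
  \<open>W x\<close> into \<open>\<kappa>\<close>. Then distinct reals of the same colour have distinct levels, so in a rational
  combination of them the term of highest level cannot be cancelled by the others
  (\<open>rationally_independent_if_distinct_levels\<close>).
\<close>

section \<open>Cardinal arithmetic\<close>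

lemma card_of_real: "|UNIV :: real set| =o ctwo ^c natLeq"
proof -
  have "|UNIV :: nat set set| =o |UNIV :: real set|"
    using nat_sets_eqpoll_reals unfolding eqpoll_def card_of_ordIso .
  moreover have "|UNIV :: nat set set| =o ctwo ^c natLeq"
    using card_of_Pow_Func[of "UNIV :: nat set"]
    by (simp add: cexp_def ctwo_def Field_natLeq Field_card_of)
  ultimately show ?thesis
    using ordIso_symmetric ordIso_transitive by blast
qed

lemma card_of_countable_le:
  assumes "Cinfinite \<kappa>" "countable C"
  shows "|C| \<le>o \<kappa>"
proof -
  have "|C| \<le>o |UNIV :: nat set|"
    using assms(2) by (auto simp: countable_def card_of_ordLeq[symmetric])
  then show ?thesis
    using natLeq_ordLeq_cinfinite[OF assms(1)] card_of_nat ordIso_ordLeq_trans ordLeq_transitive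
    by blast
qed

text \<open>If all fibres were finite, \<open>B\<close> would be a union of \<open>\<bar>I\<bar>\<close> finite sets and hence no larger than \<open>I\<close>.\<close>

lemma infinite_fibre_if_card_less:
  assumes "infinite I" "|I| <o |B|" "f ` B \<subseteq> I"
  shows "\<exists>i\<in>I. infinite {b \<in> B. f b = i}"
proof (rule ccontr)
  assume "\<not> ?thesis"
  then have "\<forall>i\<in>I. |{b \<in> B. f b = i}| \<le>o |I|"
    using \<open>infinite I\<close> card_of_ordLeq_finite
      ordLeq_total[OF card_of_Well_order card_of_Well_order] by metis
  then have "|\<Union>i\<in>I. {b \<in> B. f b = i}| \<le>o |I|"
    using \<open>infinite I\<close> by (intro card_of_UNION_ordLeq_infinite) (auto simp: card_of_mono1)
  moreover have "(\<Union>i\<in>I. {b \<in> B. f b = i}) = B"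
    using assms(3) by auto
  ultimately show False
    using assms(2) not_ordLess_ordLeq by auto
qed

section \<open>A cover forces the continuum to be at most the successor\<close>

text \<open>The four corners are pairwise distinct, and their alternating sum with
  coefficients \<open>1, -1, -1, 1\<close> vanishes.\<close>

lemma rationally_independent_no_rectangle:
  assumes X: "rationally_independent X"
    and "a + b \<in> X" "a' + b \<in> X" "a + b' \<in> X" "a' + b' \<in> X"
    and "a \<noteq> a'" "b \<noteq> b'" "a + b \<noteq> a' + b'" "a' + b \<noteq> a + b'"
  shows False
proof -
  define x where "x = (\<lambda>i::nat. [a + b, a' + b, a + b', a' + b'] ! i)"
  define q where "q = (\<lambda>i::nat. [1, -1, -1, 1 :: rat] ! i)"
  have lt: "{..<4::nat} = {0,1,2,3}"
    by auto
  have "(\<forall>i<4. x i \<in> X) \<and> inj_on x {..<4} \<and> (\<forall>i<4. q i \<noteq> 0)"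
    unfolding lt using assms(2-)
    by (auto simp: x_def q_def less_Suc_eq numeral_eq_Suc)
  moreover have "(\<Sum>i<4. of_rat (q i) * x i) = 0"
    unfolding lt by (simp add: x_def q_def numeral_eq_Suc)
  ultimately show False
    using X unfolding rationally_independent_def by (metis one_le_numeral)
qed

text \<open>The rectangle argument. The pigeonhole principle is used twice: with \<open>\<kappa>\<^sup>+\<close> translates against \<open>\<kappa>\<close>
  colours, and then with more than \<open>\<kappa>\<^sup>+\<close> reals against \<open>\<kappa>\<^sup>+\<close> triples.\<close>

lemma card_of_real_le_cardSuc_if_covered:
  assumes \<kappa>: "Cinfinite \<kappa>"
    and cov: "covered_by_rationally_independent \<kappa> (UNIV - {0})"
  shows "|UNIV :: real set| \<le>o cardSuc \<kappa>"
proof (rule ccontr)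
  assume "\<not> ?thesis"
  then have less: "cardSuc \<kappa> <o |UNIV :: real set|"
    using \<kappa> by (meson cardSuc_Card_order card_of_Well_order cardSuc_Well_order not_ordLeq_iff_ordLess)
  have co: "Card_order \<kappa>" "Card_order (cardSuc \<kappa>)" and inf: "infinite (Field \<kappa>)"
    using \<kappa> cardSuc_Card_order by (auto simp: cinfinite_def)
  have "|Field (cardSuc \<kappa>)| \<le>o |UNIV :: real set|"
    using less co(2) by (meson card_of_Field_ordIso ordIso_ordLess_trans ordLess_imp_ordLeq)
  then obtain f :: "'a set \<Rightarrow> real" where f: "inj_on f (Field (cardSuc \<kappa>))"
    unfolding card_of_ordLeq[symmetric] by auto
  define A where "A = f ` Field (cardSuc \<kappa>)"
  have A: "|A| =o cardSuc \<kappa>"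
    unfolding A_def using f co(2)
    by (meson card_of_Field_ordIso card_of_ordIsoI inj_on_imp_bij_betw ordIso_symmetric ordIso_transitive)
  obtain X where X: "\<And>i. i \<in> Field \<kappa> \<Longrightarrow> rationally_independent (X i)"
    and sub: "UNIV - {0} \<subseteq> (\<Union>i\<in>Field \<kappa>. X i)"
    using cov unfolding covered_by_rationally_independent_def by blast
  \<comment> \<open>The number \<open>0\<close>, which no independent set contains, gets an arbitrary colour; this keeps the
    colouring total, at the price of having to avoid \<open>0\<close> as a corner later.\<close>
  have "\<exists>i\<in>Field \<kappa>. x \<noteq> 0 \<longrightarrow> x \<in> X i" for x
    using sub inf by (cases "x = 0") (auto dest: infinite_imp_nonempty)
  then obtain c where c: "\<And>x. c x \<in> Field \<kappa>" "\<And>x. x \<noteq> 0 \<Longrightarrow> x \<in> X (c x)"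
    by metis
  have \<kappa>A: "|Field \<kappa>| <o |A|"
    using co A cardSuc_greater card_of_Field_ordIso
    by (meson ordIso_ordLess_trans ordIso_symmetric ordLess_ordIso_trans)
  have infA: "infinite A"
    using \<kappa>A inf card_of_ordLeq_infinite ordLess_imp_ordLeq by blast
  have "\<exists>a a'. a \<in> A \<and> a' \<in> A \<and> a \<noteq> a' \<and> c (a + b) = c (a' + b)" for b
  proof -
    have "\<not> inj_on (\<lambda>a. c (a + b)) A"
    proof
      assume "inj_on (\<lambda>a. c (a + b)) A"
      then have "|A| \<le>o |Field \<kappa>|"
        using c(1) by (intro card_of_ordLeqI) auto
      then show False
        using \<kappa>A not_ordLess_ordLeq by blast
    qed
    then show ?thesis
      unfolding inj_on_def by blast
  qed
  then obtain l r where lr: "\<And>b. l b \<in> A" "\<And>b. r b \<in> A" "\<And>b. l b \<noteq> r b"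
      "\<And>b. c (l b + b) = c (r b + b)"
    by metis
  define T where "T = (\<lambda>b. (l b, r b, c (l b + b)))"
  have "|A \<times> A \<times> Field \<kappa>| \<le>o |A|"
    using \<kappa>A infA ordLess_imp_ordLeq[OF \<kappa>A] card_of_Card_order[of A]
    by (intro card_of_Times_ordLeq_infinite_Field) (simp_all add: Field_card_of card_of_mono1)
  then have "|A \<times> A \<times> Field \<kappa>| <o |UNIV :: real set|"
    using A less by (meson ordIso_ordLess_trans ordLeq_ordLess_trans)
  moreover have "infinite (A \<times> A \<times> Field \<kappa>)"
    using inf infA by (auto simp: finite_cartesian_product_iff)
  moreover have "range T \<subseteq> A \<times> A \<times> Field \<kappa>"
    using lr c(1) by (auto simp: T_def)
  ultimately obtain t where "infinite {b \<in> UNIV. T b = t}"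
    using infinite_fibre_if_card_less by blast
  moreover obtain a a' k where t: "t = (a, a', k)"
    by (cases t)
  ultimately have S: "infinite {b. T b = (a, a', k)}" (is "infinite ?S")
    by simp
  \<comment> \<open>The fibre being infinite, its two members can avoid the finitely many values
    that make a corner vanish or two corners coincide.\<close>
  obtain b where b: "b \<in> ?S" "b \<notin> {- a, - a'}"
    using S by (meson finite.emptyI finite.insertI finite_subset subsetI)
  obtain b' where b': "b' \<in> ?S" "b' \<notin> {- a, - a', b, a + b - a', a' + b - a}"
    using S by (meson finite.emptyI finite.insertI finite_subset subsetI)
  have "T b = (a, a', k)" "T b' = (a, a', k)"
    using b b' by auto
  then have k: "c (a + b) = k" "c (a' + b) = k" "c (a + b') = k" "c (a' + b') = k" "a \<noteq> a'"
    unfolding T_def using lr by (metis prod.inject)+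
  have "rationally_independent (X k)"
    using X c(1) k(1) by blast
  moreover have "a + b \<in> X k" "a' + b \<in> X k" "a + b' \<in> X k" "a' + b' \<in> X k"
    using b b' c(2)[of "a + b"] c(2)[of "a' + b"] c(2)[of "a + b'"] c(2)[of "a' + b'"] k
    by (auto simp: add_eq_0_iff2)
  ultimately show False
    by (rule rationally_independent_no_rectangle) (use b' k in auto)
qed

section \<open>The real line as a rational vector space\<close>

interpretation rat_real: vector_space "\<lambda>(q :: rat) (x :: real). of_rat q * x"
  by unfold_locales (simp_all add: algebra_simps of_rat_add of_rat_mult)

text \<open>The span is exhausted by the sets \<open>(G ^^ n) {0}\<close> of combinations with \<open>n\<close> terms, each of which is an
  image of a product of sets of size at most \<open>\<kappa>\<close>.\<close>

lemma card_of_rat_span_le: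
  assumes \<kappa>: "Cinfinite \<kappa>" and A: "|A| \<le>o \<kappa>"
  shows "|rat_real.span A| \<le>o \<kappa>"
proof -
  have co: "Card_order \<kappa>" and inf: "infinite (Field \<kappa>)"
    using \<kappa> by (auto simp: cinfinite_def)
  define G :: "real set \<Rightarrow> real set" where
    "G S = (\<lambda>(q :: rat, x, y). of_rat q * x + y) ` (UNIV \<times> A \<times> S)" for S
  have "|(G ^^ n) {0}| \<le>o \<kappa>" for n
  proof (induction n)
    case 0
    show ?case by (simp add: card_of_countable_le[OF \<kappa>])
  next
    case (Suc n)
    then have "|(UNIV :: rat set) \<times> A \<times> (G ^^ n) {0}| \<le>o \<kappa>"
      using A card_of_countable_le[OF \<kappa>, of "UNIV :: rat set"]
      by (intro card_of_Times_ordLeq_infinite_Field inf co) auto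
    then show ?case
      unfolding funpow.simps o_apply G_def[of "(G ^^ n) {0}"]
      using card_of_image ordLeq_transitive by blast
  qed
  then have "|\<Union>n. (G ^^ n) {0}| \<le>o \<kappa>"
    by (intro card_of_UNION_ordLeq_infinite_Field inf co card_of_countable_le[OF \<kappa>]) auto
  moreover have "rat_real.span A \<subseteq> (\<Union>n. (G ^^ n) {0})"
  proof
    fix x assume "x \<in> rat_real.span A"
    then show "x \<in> (\<Union>n. (G ^^ n) {0})"
    proof (induction rule: rat_real.span_induct_alt)
      case base
      have "0 \<in> (G ^^ 0) {0}" by simp
      then show ?case by blast
    next
      case (step q x y)
      then obtain n where "y \<in> (G ^^ n) {0}" by blast
      then have "of_rat q * x + y \<in> (G ^^ Suc n) {0}"
        using step by (force simp: G_def)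
      then show ?case by blast
    qed
  qed
  ultimately show ?thesis
    using card_of_mono1 ordLeq_transitive by blast
qed

section \<open>A filtration by small subspaces yields a cover\<close>

lemma finite_obtains_chain_max:
  fixes W :: "'i \<Rightarrow> 'b set"
  assumes "finite I" "I \<noteq> {}" and chain: "\<And>i j. W i \<subseteq> W j \<or> W j \<subseteq> W i"
  obtains j where "j \<in> I" "\<And>i. i \<in> I \<Longrightarrow> W i \<subseteq> W j"
proof -
  obtain M where "M \<in> W ` I" "\<forall>N\<in>W ` I. M \<subseteq> N \<longrightarrow> M = N"
    using finite_has_maximal[of "W ` I"] assms(1,2) by auto
  then show ?thesis
    using that chain by (metis (no_types, lifting) image_iff imageI subset_refl)
qed

text \<open>\<open>W x\<close> is the level of \<open>x\<close>: the least member of a chain of subspaces that contains \<open>x\<close>. Solving a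
  vanishing combination for its element of highest level puts that element in the span of the
  others. These all lie in the highest of their own levels, which is strictly smaller.\<close>

lemma rationally_independent_if_distinct_levels:
  assumes sub: "\<And>x. rat_real.subspace (W x)"
    and mem: "\<And>x. x \<in> W x"
    and chain: "\<And>x y. W x \<subseteq> W y \<or> W y \<subseteq> W x"
    and least: "\<And>x y. x \<in> W y \<Longrightarrow> W x \<subseteq> W y"
    and inj: "inj_on W X" and zero: "0 \<notin> X"
  shows "rationally_independent X"
  unfolding rationally_independent_def
proof (intro allI impI notI)
  fix n :: nat and x :: "nat \<Rightarrow> real" and q :: "nat \<Rightarrow> rat"
  assume n: "1 \<le> n"
    and asm: "(\<forall>i<n. x i \<in> X) \<and> inj_on x {..<n} \<and> (\<forall>i<n. q i \<noteq> 0)"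
    and sum0: "(\<Sum>i<n. of_rat (q i) * x i) = 0"
  have injW: "i = j" if "i < n" "j < n" "W (x i) = W (x j)" for i j
    using that asm inj by (metis inj_onD lessThan_iff)
  obtain m where m: "m < n" "\<And>i. i < n \<Longrightarrow> W (x i) \<subseteq> W (x m)"
    using finite_obtains_chain_max[of "{..<n}" "\<lambda>i. W (x i)"] n chain
    by (metis finite_lessThan lessThan_iff lessThan_empty_iff not_one_le_zero)
  have "x m \<in> rat_real.span (x ` ({..<n} - {m}))"
  proof -
    have "of_rat (q m) * x m + (\<Sum>i\<in>{..<n} - {m}. of_rat (q i) * x i) = 0"
      using sum0 m(1) sum.remove[of "{..<n}" m "\<lambda>i. of_rat (q i) * x i"] by simp
    then have "of_rat (q m) * x m = - (\<Sum>i\<in>{..<n} - {m}. of_rat (q i) * x i)"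
      by linarith
    also have "\<dots> \<in> rat_real.span (x ` ({..<n} - {m}))"
      by (intro rat_real.span_neg rat_real.span_sum rat_real.span_scale rat_real.span_base) auto
    finally have "of_rat (inverse (q m)) * (of_rat (q m) * x m) \<in> rat_real.span (x ` ({..<n} - {m}))"
      by (rule rat_real.span_scale)
    moreover have "of_rat (inverse (q m)) * (of_rat (q m) * x m) = x m"
      using asm m(1) by (simp add: of_rat_inverse)
    ultimately show ?thesis by (simp only:)
  qed
  moreover have "x m \<noteq> 0"
    using zero asm m(1) by metis
  \<comment> \<open>A combination with a single term would give \<open>x m = 0\<close>.\<close>
  ultimately have ne: "{..<n} - {m} \<noteq> {}"
    by (metis rat_real.span_empty image_empty singletonD)
  obtain k where k: "k \<in> {..<n} - {m}" "\<And>i. i \<in> {..<n} - {m} \<Longrightarrow> W (x i) \<subseteq> W (x k)"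
    using finite_obtains_chain_max[of "{..<n} - {m}" "\<lambda>i. W (x i)"] ne chain by auto
  have "x ` ({..<n} - {m}) \<subseteq> W (x k)"
    using k(2) mem by blast
  then have "x m \<in> W (x k)"
    using \<open>x m \<in> rat_real.span _\<close> sub rat_real.span_minimal by blast
  then have "W (x m) = W (x k)"
    using least m(2) k(1) by blast
  then show False
    using injW m(1) k(1) by blast
qed

text \<open>A well-order of the reals of minimal type has proper initial segments of size less than \<open>\<bar>\<real>\<bar>\<close>, so at
  most \<open>\<kappa>\<close>. Here \<open>L x\<close> is the first point such that \<open>x\<close> is in the span of the segment up to it.\<close>

lemma ex_small_subspace_filtration:
  assumes \<kappa>: "Cinfinite \<kappa>" and le: "|UNIV :: real set| \<le>o cardSuc \<kappa>"
  obtains W :: "real \<Rightarrow> real set"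
  where "\<And>x. rat_real.subspace (W x)" "\<And>x. x \<in> W x"
    "\<And>x y. W x \<subseteq> W y \<or> W y \<subseteq> W x" "\<And>x y. x \<in> W y \<Longrightarrow> W x \<subseteq> W y"
    "\<And>x. |W x| \<le>o \<kappa>"
proof -
  have co: "Card_order \<kappa>" and inf: "infinite (Field \<kappa>)"
    using \<kappa> by (auto simp: cinfinite_def)
  define r where "r = |UNIV :: real set|"
  have F: "Field r = UNIV" and r: "Card_order r"
    unfolding r_def by (rule Field_card_of card_of_Card_order)+
  interpret wo: wo_rel r
    unfolding wo_rel_def r_def by (rule card_of_Well_order)
  have mono: "rat_real.span (under r a) \<subseteq> rat_real.span (under r b)" if "(a, b) \<in> r" for a b
    using that wo.TRANS by (intro rat_real.span_mono under_incr)
  have small: "|rat_real.span (under r a)| \<le>o \<kappa>" for a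
  proof (rule card_of_rat_span_le[OF \<kappa>])
    have "|underS r a| <o cardSuc \<kappa>"
      using card_of_underS[OF r, of a] F le unfolding r_def
      by (metis UNIV_I ordLess_ordLeq_trans)
    then have "|underS r a| \<le>o \<kappa>"
      using cardSuc_ordLeq_ordLess[OF co card_of_Card_order] by blast
    moreover have "under r a = underS r a \<union> {a}"
      using F wo.REFL by (simp add: Refl_under_underS)
    moreover have "|{a}| \<le>o \<kappa>"
      by (rule card_of_countable_le[OF \<kappa>]) simp
    ultimately show "|under r a| \<le>o \<kappa>"
      using card_of_Un_ordLeq_infinite_Field[OF inf _ _ co] by metis
  qed
  define P where "P x = {a. x \<in> rat_real.span (under r a)}" for x
  define L where "L x = wo.minim (P x)" for x
  have "x \<in> P x" for x
    unfolding P_def using wo.REFL F by (auto intro!: rat_real.span_base simp: under_def refl_on_def)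
  then have L: "x \<in> rat_real.span (under r (L x))" for x
    using wo.minim_in[of "P x"] F unfolding L_def P_def by blast
  have L_le: "(L x, a) \<in> r" if "x \<in> rat_real.span (under r a)" for x a
    unfolding L_def using that F by (intro wo.minim_least) (auto simp: P_def)
  show thesis
  proof (rule that[of "\<lambda>x. rat_real.span (under r (L x))"])
    show "rat_real.span (under r (L x)) \<subseteq> rat_real.span (under r (L y)) \<or>
        rat_real.span (under r (L y)) \<subseteq> rat_real.span (under r (L x))" for x y
      using mono wo.TOTALS F by blast
  qed (use L L_le mono small in auto)
qed

text \<open>The injection \<open>g\<close> is chosen per level and not per real, so that two reals of equal level are
  compared by the same injection and must differ in colour.\<close>

lemma covered_if_card_of_real_le_cardSuc:
  assumes \<kappa>: "Cinfinite \<kappa>" and le: "|UNIV :: real set| \<le>o cardSuc \<kappa>"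
  shows "covered_by_rationally_independent \<kappa> (UNIV - {0})"
proof -
  obtain W :: "real \<Rightarrow> real set"
    where W: "\<And>x. rat_real.subspace (W x)" "\<And>x. x \<in> W x"
      "\<And>x y. W x \<subseteq> W y \<or> W y \<subseteq> W x" "\<And>x y. x \<in> W y \<Longrightarrow> W x \<subseteq> W y"
      and small: "\<And>x. |W x| \<le>o \<kappa>"
    using ex_small_subspace_filtration[OF assms] by blast
  have "\<exists>g. inj_on g (W x) \<and> g ` W x \<subseteq> Field \<kappa>" for x
    unfolding card_of_ordLeq using small \<kappa>
    by (meson card_of_Field_ordIso ordIso_symmetric ordLeq_ordIso_trans)
  then have "\<forall>U\<in>range W. \<exists>g. inj_on g U \<and> g ` U \<subseteq> Field \<kappa>"
    by blast
  then obtain g where g: "\<And>x. inj_on (g (W x)) (W x)" "\<And>x. g (W x) ` W x \<subseteq> Field \<kappa>"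
    by (metis (no_types, lifting) rangeI)
  define c where "c x = g (W x) x" for x
  have "rationally_independent {x. x \<noteq> 0 \<and> c x = i}" for i
  proof (rule rationally_independent_if_distinct_levels[OF W])
    show "inj_on W {x. x \<noteq> 0 \<and> c x = i}"
      unfolding inj_on_def c_def using g(1) W(2) by (auto simp: inj_on_def) metis
  qed auto
  moreover have "c x \<in> Field \<kappa>" for x
    using g(2) W(2) unfolding c_def by blast
  ultimately show ?thesis
    unfolding covered_by_rationally_independent_def
    by (intro exI[of _ "\<lambda>i. {x. x \<noteq> 0 \<and> c x = i}"]) auto
qed

theorem theorem3p2:
  fixes \<kappa> :: "'k rel"
  assumes "Cinfinite \<kappa>"
  shows "ctwo ^c natLeq \<le>o cardSuc \<kappa> \<longleftrightarrow>
         covered_by_rationally_independent \<kappa> (UNIV - {0})"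
proof -
  have "ctwo ^c natLeq \<le>o cardSuc \<kappa> \<longleftrightarrow> |UNIV :: real set| \<le>o cardSuc \<kappa>"
    using ordIso_ordLeq_trans[OF card_of_real] ordIso_ordLeq_trans[OF ordIso_symmetric[OF card_of_real]]
    by blast
  then show ?thesis
    using card_of_real_le_cardSuc_if_covered[OF assms] covered_if_card_of_real_le_cardSuc[OF assms]
    by blast
qed

end
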